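(* Let $Y$ be a Banach space and $N\in\mathbb{N}$. The pair $(\ell_1^N;Y)$ has property $\mathbf{L}_{p,p}$ for operators if and only if the following holds: given $\varepsilon>0$, a nonempty set $A\subset\{1,\ldots,N\}$ and $(\alpha_j)_{j\in A}$ with $\alpha_j>0$ for all $j\in A$ and $\sum_{j\in A}\alpha_j=1$, there is $\eta=\eta(\varepsilon,(\alpha_j)_{j\in A})>0$ such that whenever $(y_j)_{j\in A}\subset S_Y$ satisfies $$\Big\|\sum_{j\in A}\alpha_jy_j\Big\|>1-\eta,$$ there are $z^*\in S_{Y^*}$ and $(z_j)_{j\in A}\subset S_Y$ such that $z^*(z_j)=1$ and $\|z_j-y_j\|<\varepsilon$ for all $j\in A$.
   Context: Banach spaces are over $\mathbb{K}=\mathbb{R}$ or $\mathbb{C}$. $\ell_1^N$ is $\mathbb{K}^N$ with the norm $\|x\|_1=\sum_{j=1}^N|x_j|$. $S_X$ is the unit sphere and $X^*$ the topological dual of $X$; $\mathcal{L}(X;Y)$ is the space of bounded linear operators from $X$ to $Y$ with the operator norm. A pair $(X;Y)$ has property $\mathbf{L}_{p,p}$ (for operators) if for every $\varepsilon>0$ and $x\in S_X$ there is $\eta(\varepsilon,x)>0$ such that whenever $T\in\mathcal{L}(X;Y)$ with $\|T\|=1$ satisfies $\|T(x)\|>1-\eta(\varepsilon,x)$, there is $S\in\mathcal{L}(X;Y)$ with $\|S\|=1$, $\|S(x)\|=1$ and $\|S-T\|<\varepsilon$. *)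

theory Defs
  imports "HOL-Analysis.Analysis"
begin

section \<open>The scalar fields\<close>

text \<open>
  Up to isometric isomorphism the members of this class are exactly \<open>\<real>\<close> and \<open>\<complex>\<close>: a member
  embeds isometrically, as a real algebra, onto \<open>\<real>\<close> or onto \<open>\<complex>\<close> inside the complex numbers.
\<close>

class real_or_complex = real_normed_field +
  assumes real_or_complex:
    "\<exists>f :: 'a \<Rightarrow> complex.
       (\<forall>x y. f (x + y) = f x + f y) \<and> (\<forall>x y. f (x * y) = f x * f y) \<and>
       (\<forall>r x. f (r *\<^sub>R x) = r *\<^sub>R f x) \<and> (\<forall>x. norm (f x) = norm x) \<and>
       (range f = \<real> \<or> range f = UNIV)"

instance real :: real_or_complex
proof
  show "\<exists>f :: real \<Rightarrow> complex.
       (\<forall>x y. f (x + y) = f x + f y) \<and> (\<forall>x y. f (x * y) = f x * f y) \<and>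
       (\<forall>r x. f (r *\<^sub>R x) = r *\<^sub>R f x) \<and> (\<forall>x. norm (f x) = norm x) \<and>
       (range f = \<real> \<or> range f = UNIV)"
    by (rule exI[of _ complex_of_real]) (auto simp: scaleR_conv_of_real Reals_def)
qed

instance complex :: real_or_complex
proof
  show "\<exists>f :: complex \<Rightarrow> complex.
       (\<forall>x y. f (x + y) = f x + f y) \<and> (\<forall>x y. f (x * y) = f x * f y) \<and>
       (\<forall>r x. f (r *\<^sub>R x) = r *\<^sub>R f x) \<and> (\<forall>x. norm (f x) = norm x) \<and>
       (range f = \<real> \<or> range f = UNIV)"
    by (rule exI[of _ id]) auto
qed


section \<open>Normed spaces over a scalar field\<close>

text \<open>
  Library normed spaces are real. A normed space over \<open>K\<close> is a real normed space together with a
  multiplication by scalars in \<open>K\<close> that extends the real one and is compatible with the norm.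
  It is a Banach space if the underlying type is of class \<^class>\<open>banach\<close>.
\<close>

locale normed_space_over = vector_space smult
  for smult :: "'k::real_or_complex \<Rightarrow> 'v::real_normed_vector \<Rightarrow> 'v" +
  assumes smult_of_real: "smult (of_real r) v = r *\<^sub>R v"
    and norm_smult: "norm (smult c v) = norm c * norm v"

lemma normed_space_over_scaleR:
  "normed_space_over (scaleR :: real \<Rightarrow> 'v::real_normed_vector \<Rightarrow> 'v)"
  by unfold_locales (simp_all add: algebra_simps)

lemma normed_space_over_times:
  "normed_space_over ((*) :: 'k::real_or_complex \<Rightarrow> 'k \<Rightarrow> 'k)"
  by unfold_locales (simp_all add: algebra_simps norm_mult scaleR_conv_of_real)

text \<open>
  The elements of \<open>\<L>(X; Y)\<close>. Their operator norm is \<^const>\<open>onorm\<close>, which depends only on the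
  underlying real spaces.
\<close>

definition bounded_operator ::
  "('k \<Rightarrow> 'x \<Rightarrow> 'x) \<Rightarrow> ('k \<Rightarrow> 'y \<Rightarrow> 'y) \<Rightarrow> ('x::real_normed_vector \<Rightarrow> 'y::real_normed_vector) \<Rightarrow> bool"
  where "bounded_operator smultX smultY T \<longleftrightarrow>
    bounded_linear T \<and> (\<forall>c x. T (smultX c x) = smultY c (T x))"

definition dual_sphere ::
  "('k::real_or_complex \<Rightarrow> 'y \<Rightarrow> 'y) \<Rightarrow> ('y::real_normed_vector \<Rightarrow> 'k) set"
  where "dual_sphere smultY = {f. bounded_operator smultY (*) f \<and> onorm f = 1}"

definition property_Lpp ::
  "('k::real_or_complex \<Rightarrow> 'x::real_normed_vector \<Rightarrow> 'x) \<Rightarrow>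
   ('k \<Rightarrow> 'y::real_normed_vector \<Rightarrow> 'y) \<Rightarrow> bool"
  where "property_Lpp smultX smultY \<longleftrightarrow>
    (\<forall>\<epsilon>>0. \<forall>x\<in>sphere (0::'x) 1. \<exists>\<eta>>0. \<forall>T :: 'x \<Rightarrow> 'y.
       bounded_operator smultX smultY T \<and> onorm T = 1 \<and> norm (T x) > 1 - \<eta> \<longrightarrow>
       (\<exists>S. bounded_operator smultX smultY S \<and> onorm S = 1 \<and> norm (S x) = 1 \<and>
            onorm (\<lambda>u. S u - T u) < \<epsilon>))"


section \<open>The space \<open>\<ell>\<^sub>1\<^sup>N\<close>\<close>

text \<open>
  The coordinates are indexed by a finite type \<^typ>\<open>'n\<close> with \<open>N\<close> elements. A type of its own is
  needed because \<^typ>\<open>'k ^ 'n\<close> carries the Euclidean norm.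
\<close>

typedef (overloaded) ('k, 'n) l1 = "UNIV :: ('n::finite \<Rightarrow> 'k::real_normed_vector) set"
  morphisms coord l1_of
  by simp

lemma coord_l1_of [simp]: "coord (l1_of f) = f"
  by (simp add: l1_of_inverse)

lemma l1_eq_iff: "x = y \<longleftrightarrow> (\<forall>j. coord x j = coord y j)"
  by (metis coord_inverse ext)

instantiation l1 :: (real_normed_vector, finite) real_normed_vector
begin

definition "0 = l1_of (\<lambda>j. 0)"
definition "x + y = l1_of (\<lambda>j. coord x j + coord y j)"
definition "x - y = l1_of (\<lambda>j. coord x j - coord y j)"
definition "- x = l1_of (\<lambda>j. - coord x j)"
definition "r *\<^sub>R x = l1_of (\<lambda>j. r *\<^sub>R coord x j)"
definition norm_l1_def: "norm x = (\<Sum>j\<in>UNIV. norm (coord x j))"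
definition "sgn x = inverse (norm x) *\<^sub>R (x :: ('a, 'b) l1)"
definition "dist x y = norm (x - y :: ('a, 'b) l1)"
definition [code del]:
  "(uniformity :: (('a, 'b) l1 \<times> ('a, 'b) l1) filter) =
     (INF e\<in>{0 <..}. principal {(x, y). dist x y < e})"
definition [code del]:
  "open (U :: ('a, 'b) l1 set) \<longleftrightarrow>
     (\<forall>x\<in>U. eventually (\<lambda>(x', y). x' = x \<longrightarrow> y \<in> U) uniformity)"

instance
proof
  fix x y :: "('a, 'b) l1" and r :: real
  show "norm x = 0 \<longleftrightarrow> x = 0"
    by (simp add: norm_l1_def zero_l1_def l1_eq_iff sum_nonneg_eq_0_iff)
  show "norm (x + y) \<le> norm x + norm y"
    by (simp add: norm_l1_def plus_l1_def sum_mono norm_triangle_ineq flip: sum.distrib)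
  show "norm (r *\<^sub>R x) = \<bar>r\<bar> * norm x"
    by (simp add: norm_l1_def scaleR_l1_def sum_distrib_left)
qed (simp_all add: zero_l1_def plus_l1_def minus_l1_def uminus_l1_def scaleR_l1_def l1_eq_iff
      sgn_l1_def dist_l1_def uniformity_l1_def open_l1_def algebra_simps)

end

definition l1_smult :: "'k::real_or_complex \<Rightarrow> ('k, 'n::finite) l1 \<Rightarrow> ('k, 'n) l1"
  where "l1_smult c x = l1_of (\<lambda>j. c * coord x j)"

lemma normed_space_over_l1_smult:
  "normed_space_over (l1_smult :: 'k::real_or_complex \<Rightarrow> ('k, 'n::finite) l1 \<Rightarrow> ('k, 'n) l1)"
  by unfold_locales
    (simp_all add: l1_smult_def l1_eq_iff plus_l1_def scaleR_l1_def norm_l1_def norm_mult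
      sum_distrib_left scaleR_conv_of_real algebra_simps)

end

theory Submission
  imports Defs
begin

text \<open>
  An operator on \<open>\<ell>\<^sub>1\<^sup>N\<close> is given by the images of the unit vectors, and its norm is the largest of
  their norms. If \<open>S\<close> has norm one and attains it at \<open>\<Sum>j\<in>A. \<alpha>\<^sub>j e\<^sub>j\<close>, a supporting functional at the
  image takes the value \<open>1\<close> at each \<open>S e\<^sub>j\<close>, because a convex combination of numbers of modulus at
  most one equals \<open>1\<close> only if each of them does. Conversely, if \<open>T\<close> almost attains its norm at
  \<open>x\<close>, the vectors \<open>T e\<^sub>j\<close> with \<open>x\<^sub>j \<noteq> 0\<close> have norm almost one, so after a rotation by the sign of
  \<open>x\<^sub>j\<close> they can be normalized and then replaced by the given \<open>z\<^sub>j\<close>.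
\<close>

section \<open>Supporting functionals\<close>

text \<open>
  The Hahn--Banach theorem is obtained by the minimality argument: a minimal element among the
  sublinear functionals below the norm is linear.
\<close>

definition sublinear_below_norm :: "('a::real_normed_vector \<Rightarrow> real) \<Rightarrow> bool"
  where "sublinear_below_norm p \<longleftrightarrow>
    (\<forall>x y. p (x + y) \<le> p x + p y) \<and> (\<forall>t>0. \<forall>x. p (t *\<^sub>R x) \<le> t * p x) \<and> (\<forall>x. p x \<le> norm x)"

lemma sublinear_below_norm_norm: "sublinear_below_norm norm"
  by (simp add: sublinear_below_norm_def norm_triangle_ineq)

text \<open>For positive \<open>t\<close>, the reverse inequality is the scaling condition for
  \<open>inverse t\<close> at the point \<open>t *\<^sub>R x\<close>. At zero, subadditivity gives
  \<open>p 0 \<ge> 0\<close> and the norm bound gives \<open>p 0 \<le> 0\<close>.\<close>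

lemma sublinear_below_norm_scaleR:
  assumes "sublinear_below_norm p" "t \<ge> 0"
  shows "p (t *\<^sub>R x) = t * p x"
proof (cases "t = 0")
  case True
  have "p (0 + 0) \<le> p 0 + p 0" "p 0 \<le> norm (0::'a)"
    using assms(1) unfolding sublinear_below_norm_def by blast+
  with True show ?thesis by simp
next
  case False
  with assms have t: "t > 0" by simp
  have "p (inverse t *\<^sub>R (t *\<^sub>R x)) \<le> inverse t * p (t *\<^sub>R x)"
    using assms(1) t unfolding sublinear_below_norm_def by (meson positive_imp_inverse_positive)
  then have "t * p x \<le> p (t *\<^sub>R x)"
    using t by (simp add: field_simps)
  moreover have "p (t *\<^sub>R x) \<le> t * p x"
    using assms(1) t unfolding sublinear_below_norm_def by blast
  ultimately show ?thesis by simp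
qed

lemma sublinear_below_norm_minus:
  assumes "sublinear_below_norm p"
  shows "- p (- x) \<le> p x"
proof -
  have "p (x + - x) \<le> p x + p (- x)"
    using assms unfolding sublinear_below_norm_def by blast
  then show ?thesis
    using sublinear_below_norm_scaleR[OF assms, of 0 x] by simp
qed

text \<open>This uniform lower bound keeps the pointwise infima over chains finite.\<close>

lemma sublinear_below_norm_ge:
  assumes "sublinear_below_norm p"
  shows "- norm x \<le> p x"
proof -
  have "p (- x) \<le> norm (- x)"
    using assms unfolding sublinear_below_norm_def by blast
  with sublinear_below_norm_minus[OF assms, of x] show ?thesis by simp
qed

text \<open>Supplies the lower bounds of chains for Zorn's lemma. An infimum of sublinear
  functionals need not be subadditive in general; in a chain, the smaller of \<open>p\<close> and
  \<open>q\<close> serves both summands at once.\<close>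

lemma sublinear_below_norm_Inf:
  assumes C: "C \<noteq> {}" "\<And>p. p \<in> C \<Longrightarrow> sublinear_below_norm p"
    and chain: "\<And>p q. p \<in> C \<Longrightarrow> q \<in> C \<Longrightarrow> p \<le> q \<or> q \<le> p"
  shows "sublinear_below_norm (\<lambda>x. INF p\<in>C. p x)" (is "sublinear_below_norm ?m")
    and "\<And>p x. p \<in> C \<Longrightarrow> (INF p\<in>C. p x) \<le> p x"
proof -
  have bdd: "bdd_below ((\<lambda>p. p x) ` C)" for x
    using sublinear_below_norm_ge[OF C(2)] by (intro bdd_belowI2[of _ "- norm x"]) auto
  show lower: "?m x \<le> p x" if "p \<in> C" for p x
    using that by (intro cINF_lower bdd)
  have add: "?m (x + y) \<le> ?m x + ?m y" for x y
  proof -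
    have pq: "?m (x + y) \<le> p x + q y" if "p \<in> C" "q \<in> C" for p q
    proof -
      have "\<exists>r\<in>C. r \<le> p \<and> r \<le> q"
        using chain[OF that] that by auto
      then obtain r where r: "r \<in> C" "r \<le> p" "r \<le> q" by blast
      have "?m (x + y) \<le> r (x + y)" using r by (intro lower)
      also have "\<dots> \<le> r x + r y"
        using C(2)[OF r(1)] unfolding sublinear_below_norm_def by blast
      also have "\<dots> \<le> p x + q y"
        using r by (intro add_mono) (auto simp: le_fun_def)
      finally show ?thesis .
    qed
    have "?m (x + y) - p x \<le> ?m y" if "p \<in> C" for p
      using pq[OF that] by (intro cINF_greatest[OF C(1)]) (simp add: algebra_simps)
    then have "?m (x + y) - ?m y \<le> ?m x"
      by (intro cINF_greatest[OF C(1)]) (simp add: algebra_simps)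
    then show ?thesis by simp
  qed
  have scale: "?m (t *\<^sub>R x) \<le> t * ?m x" if "t > 0" for t x
  proof -
    have "?m (t *\<^sub>R x) / t \<le> p x" if "p \<in> C" for p
      using lower[OF that, of "t *\<^sub>R x"] sublinear_below_norm_scaleR[OF C(2)[OF that], of t x] \<open>t > 0\<close>
      by (simp add: field_simps)
    then have "?m (t *\<^sub>R x) / t \<le> ?m x" by (intro cINF_greatest[OF C(1)])
    with \<open>t > 0\<close> show ?thesis by (simp add: field_simps)
  qed
  have le: "?m x \<le> norm x" for x
  proof -
    obtain p where "p \<in> C" using C(1) by blast
    then have "?m x \<le> p x" "p x \<le> norm x"
      using lower C(2) unfolding sublinear_below_norm_def by blast+
    then show ?thesis by simp
  qed
  show "sublinear_below_norm ?m"
    unfolding sublinear_below_norm_def using add scale le by blast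
qed

text \<open>The infimum of \<open>p (y + t *\<^sub>R v) - t * p v\<close> over
  \<open>t \<ge> 0\<close> lowers \<open>p\<close> in the direction \<open>v\<close>:
  \<open>t = 0\<close> gives \<open>q \<le> p\<close> and \<open>t = 1\<close> the last claim. If
  \<open>p\<close> is minimal, then \<open>q = p\<close> and that claim is superadditivity.\<close>

lemma sublinear_below_norm_shift:
  assumes p: "sublinear_below_norm p"
  obtains q where "sublinear_below_norm q" "q \<le> p" "\<And>y. q y \<le> p (y + v) - p v"
proof -
  define q where "q y = (INF t\<in>{0..}. p (y + t *\<^sub>R v) - t * p v)" for y
  have padd: "p (x + y) \<le> p x + p y" for x y
    using p unfolding sublinear_below_norm_def by blast
  have lb: "- p (- y) \<le> p (y + t *\<^sub>R v) - t * p v" if "t \<ge> 0" for y t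
    using padd[of "y + t *\<^sub>R v" "- y"] sublinear_below_norm_scaleR[OF p that, of v] by simp
  have lower: "q y \<le> p (y + t *\<^sub>R v) - t * p v" if "t \<ge> 0" for y t
    unfolding q_def using that lb
    by (intro cINF_lower bdd_belowI2[of _ "- p (- y)"]) auto
  have greatest: "a \<le> q y" if "\<And>t. t \<ge> 0 \<Longrightarrow> a \<le> p (y + t *\<^sub>R v) - t * p v" for a y
    unfolding q_def using that by (intro cINF_greatest) auto
  have le: "q y \<le> p y" for y
    using lower[of 0 y] by simp
  have add: "q (x + y) \<le> q x + q y" for x y
  proof -
    \<comment> \<open>The parameters \<open>s\<close> and \<open>t\<close> are chosen independently
      for the two summands; their sum is admissible for \<open>x + y\<close>.\<close>
    have st: "q (x + y) \<le> (p (x + s *\<^sub>R v) - s * p v) + (p (y + t *\<^sub>R v) - t * p v)"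
      if "s \<ge> 0" "t \<ge> 0" for s t
    proof -
      have "q (x + y) \<le> p ((x + y) + (s + t) *\<^sub>R v) - (s + t) * p v"
        using that by (intro lower) simp
      moreover have "p ((x + y) + (s + t) *\<^sub>R v) \<le> p (x + s *\<^sub>R v) + p (y + t *\<^sub>R v)"
        using padd[of "x + s *\<^sub>R v" "y + t *\<^sub>R v"] by (simp add: algebra_simps)
      ultimately show ?thesis by (simp add: algebra_simps)
    qed
    have "q (x + y) - (p (x + s *\<^sub>R v) - s * p v) \<le> q y" if "s \<ge> 0" for s
      using st[OF that] by (intro greatest) (simp add: algebra_simps)
    then have "q (x + y) - q y \<le> q x"
      by (intro greatest) (simp add: algebra_simps)
    then show ?thesis by simp
  qed
  have scale: "q (c *\<^sub>R x) \<le> c * q x" if c: "c > 0" for c x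
  proof -
    have "q (c *\<^sub>R x) / c \<le> p (x + t *\<^sub>R v) - t * p v" if "t \<ge> 0" for t
    proof -
      have "q (c *\<^sub>R x) \<le> p (c *\<^sub>R x + (c * t) *\<^sub>R v) - (c * t) * p v"
        using that c by (intro lower) simp
      also have "c *\<^sub>R x + (c * t) *\<^sub>R v = c *\<^sub>R (x + t *\<^sub>R v)"
        by (simp add: algebra_simps)
      finally show ?thesis
        using c sublinear_below_norm_scaleR[OF p, of c "x + t *\<^sub>R v"] by (simp add: field_simps)
    qed
    then have "q (c *\<^sub>R x) / c \<le> q x" by (rule greatest)
    with c show ?thesis by (simp add: field_simps)
  qed
  have "q x \<le> norm x" for x
    using le[of x] p unfolding sublinear_below_norm_def by (meson order_trans)
  with add scale have "sublinear_below_norm q"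
    unfolding sublinear_below_norm_def by blast
  moreover have "q \<le> p" using le by (simp add: le_fun_def)
  moreover have "q y \<le> p (y + v) - p v" for y using lower[of 1 y] by simp
  ultimately show ?thesis by (rule that)
qed

lemma sublinear_below_norm_minimal_bounded_linear:
  assumes m: "sublinear_below_norm m"
    and min: "\<And>q. sublinear_below_norm q \<Longrightarrow> q \<le> m \<Longrightarrow> q = m"
  shows "bounded_linear m"
proof -
  have add: "m (x + y) = m x + m y" for x y
  proof (rule antisym)
    show "m (x + y) \<le> m x + m y"
      using m unfolding sublinear_below_norm_def by blast
    obtain q where "sublinear_below_norm q" "q \<le> m" "\<And>z. q z \<le> m (z + y) - m y"
      using sublinear_below_norm_shift[OF m, of y] by blast
    then have "m x \<le> m (x + y) - m y" using min by metis
    then show "m x + m y \<le> m (x + y)" by simp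
  qed
  have neg: "m (- x) = - m x" for x
    using add[of x "- x"] sublinear_below_norm_scaleR[OF m, of 0 x] by simp
  have scale: "m (t *\<^sub>R x) = t * m x" for t x
  proof (cases "t \<ge> 0")
    case False
    then show ?thesis
      using sublinear_below_norm_scaleR[OF m, of "- t" x] neg[of "t *\<^sub>R x"] by simp
  qed (rule sublinear_below_norm_scaleR[OF m])
  have "m x \<le> norm x" for x using m unfolding sublinear_below_norm_def by blast
  then have "\<bar>m x\<bar> \<le> norm x" for x
    using sublinear_below_norm_ge[OF m, of x] by (simp add: abs_le_iff minus_le_iff)
  then show ?thesis
    using add scale by (intro bounded_linear_intro[where K = 1]) auto
qed

lemma supporting_functional_real:
  fixes v :: "'a::real_normed_vector"
  obtains u where "bounded_linear u" "u v = norm v" "\<And>x. u x \<le> norm x"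
proof -
  \<comment> \<open>For a linear functional the extra condition says that its value at
    \<open>v\<close> is at least \<open>norm v\<close>. It is inherited by smaller functionals,
    whereas a lower bound at \<open>v\<close> would not be.\<close>
  define H :: "('a \<Rightarrow> real) set"
    where "H = {p. sublinear_below_norm p \<and> p (- v) \<le> - norm v}"
  have "\<exists>m\<in>H. \<forall>a\<in>H. m \<ge> a \<longrightarrow> a = m"
  proof (rule predicate_Zorn)
    show "partial_order_on H (relation_of (\<ge>) H)"
      by (rule partial_order_on_relation_ofI) auto
    fix C assume "C \<in> Chains (relation_of (\<ge>) H)"
    then have chain: "\<And>p q. p \<in> C \<Longrightarrow> q \<in> C \<Longrightarrow> p \<le> q \<or> q \<le> p"
      and CH: "\<And>p. p \<in> C \<Longrightarrow> p \<in> H"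
      by (auto simp: Chains_def relation_of_def)
    show "\<exists>u\<in>H. \<forall>a\<in>C. a \<ge> u"
    proof (cases "C = {}")
      case True
      \<comment> \<open>The empty chain requires an element of \<open>H\<close>: shifting the norm
        along \<open>v\<close> bounds the value at \<open>- v\<close> by
        \<open>norm 0 - norm v\<close>.\<close>
      obtain q where "sublinear_below_norm q" "q \<le> norm" "\<And>y. q y \<le> norm (y + v) - norm v"
        using sublinear_below_norm_shift[OF sublinear_below_norm_norm, of v] by blast
      from this(1) this(3)[of "- v"] have "q \<in> H" by (simp add: H_def)
      with True show ?thesis by blast
    next
      case False
      have sub: "sublinear_below_norm p" if "p \<in> C" for p
        using CH[OF that] by (simp add: H_def)
      have Inf: "sublinear_below_norm (\<lambda>x. INF p\<in>C. p x)"
        and Inf_le: "\<And>p x. p \<in> C \<Longrightarrow> (INF p\<in>C. p x) \<le> p x"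
        by (rule sublinear_below_norm_Inf; use False sub chain in blast)+
      obtain p where p: "p \<in> C" using False by blast
      have "(INF p\<in>C. p (- v)) \<le> - norm v"
        using Inf_le[OF p, of "- v"] CH[OF p] by (auto simp: H_def intro: order_trans)
      then have "(\<lambda>x. INF p\<in>C. p x) \<in> H"
        using Inf by (simp add: H_def)
      moreover have "(\<lambda>x. INF p\<in>C. p x) \<le> a" if "a \<in> C" for a
        using Inf_le that by (simp add: le_fun_def)
      ultimately show ?thesis by blast
    qed
  qed
  then obtain m where "m \<in> H" and min: "\<And>a. a \<in> H \<Longrightarrow> a \<le> m \<Longrightarrow> a = m" by blast
  then have m: "sublinear_below_norm m" "m (- v) \<le> - norm v" by (auto simp: H_def)
  \<comment> \<open>Since \<open>H\<close> is closed downwards, minimality in \<open>H\<close> is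
    minimality among all sublinear functionals below the norm.\<close>
  have "q \<in> H" if "sublinear_below_norm q" "q \<le> m" for q
    using that m(2) by (auto simp: H_def le_fun_def intro: order_trans)
  then have lin: "bounded_linear m"
    using min by (intro sublinear_below_norm_minimal_bounded_linear[OF m(1)]) blast
  have le: "m x \<le> norm x" for x using m(1) unfolding sublinear_below_norm_def by blast
  have "m v = norm v"
    using m(2) le[of v] bounded_linear.linear[OF lin] by (simp add: linear_neg)
  then show ?thesis using that lin le by blast
qed

section \<open>Real parts of scalars and convex combinations equal to one\<close>

text \<open>
  The imaginary unit of the scalar field is represented by \<open>iu = 0\<close> in the real case, so that both
  cases have the form \<open>c = of_real (re c) + of_real (im c) * iu\<close>.
\<close>

lemma real_or_complex_coordinates:
  obtains re im :: "'k::real_or_complex \<Rightarrow> real" and iu :: 'k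
  where "linear re" "re 1 = 1" "re iu = 0" "\<And>c. re c \<le> norm c"
    and "\<And>c. norm c \<le> re c \<Longrightarrow> c = of_real (re c)"
    and "\<And>c. c = of_real (re c) + of_real (im c) * iu"
    and "iu = 0 \<or> iu * iu = -1"
proof -
  obtain f :: "'k \<Rightarrow> complex" where add: "\<And>x y. f (x + y) = f x + f y"
    and mult: "\<And>x y. f (x * y) = f x * f y" and scale: "\<And>r x. f (r *\<^sub>R x) = r *\<^sub>R f x"
    and norm: "\<And>x. norm (f x) = norm x" and range: "range f = \<real> \<or> range f = UNIV"
    using real_or_complex by metis
  have lin: "linear f" using add scale by (intro linearI)
  have inj: "x = y" if "f x = f y" for x y
    using that norm[of "x - y"] by (simp add: linear_diff[OF lin])
  \<comment> \<open>A nonzero idempotent complex number is one.\<close>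
  have "f 1 * f 1 = f 1" "f 1 \<noteq> 0"
    using mult[of 1 1] norm[of 1] by auto
  then have one: "f 1 = 1" by simp
  then have real: "f (of_real r) = of_real r" for r
    using scale[of r 1] by (simp add: scaleR_conv_of_real)
  define iu where "iu = (if range f = UNIV then inv f \<i> else 0)"
  have fi: "f iu = (if range f = UNIV then \<i> else 0)"
    using linear_0[OF lin] by (simp add: iu_def f_inv_into_f)
  show ?thesis
  proof (rule that[of "\<lambda>c. Re (f c)" iu "\<lambda>c. Im (f c)"])
    show "linear (\<lambda>c. Re (f c))"
      by (rule linearI) (simp_all add: add scale)
    show "Re (f 1) = 1" "Re (f iu) = 0"
      by (simp_all add: one fi)
    show "Re (f c) \<le> norm c" for c
      using complex_Re_le_cmod[of "f c"] by (simp add: norm)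
    show "c = of_real (Re (f c)) + of_real (Im (f c)) * iu" for c
    proof (rule inj, cases "range f = UNIV")
      case False
      with range have "f c \<in> \<real>" by blast
      then show "f c = f (of_real (Re (f c)) + of_real (Im (f c)) * iu)"
        using False by (simp add: add mult real fi)
    qed (simp add: add mult real fi complex_eq_iff)
    show "c = of_real (Re (f c))" if le: "norm c \<le> Re (f c)" for c
    proof (rule inj)
      have "cmod (f c) \<le> Re (f c)" using le by (simp add: norm)
      then have "(Re (f c))\<^sup>2 + (Im (f c))\<^sup>2 \<le> (Re (f c))\<^sup>2"
        by (metis cmod_power2 norm_ge_zero power_mono)
      then show "f c = f (of_real (Re (f c)))" by (simp add: real complex_eq_iff)
    qed
    show "iu = 0 \<or> iu * iu = -1"
    proof (cases "range f = UNIV")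
      case True
      have "iu * iu = -1"
      proof (rule inj)
        show "f (iu * iu) = f (-1)"
          using True one by (simp add: mult fi linear_neg[OF lin])
      qed
      then show ?thesis ..
    qed (simp add: iu_def)
  qed
qed

text \<open>The defects \<open>1 - re (w i)\<close> are nonnegative and have weighted sum zero, so
  all vanish. A scalar of modulus at most one with real part one has no imaginary part.\<close>

lemma convex_combination_eq_one:
  fixes w :: "'n \<Rightarrow> 'k::real_or_complex"
  assumes A: "finite A" "\<And>j. j \<in> A \<Longrightarrow> \<alpha> j > 0" "(\<Sum>j\<in>A. \<alpha> j) = 1"
    and le: "\<And>j. j \<in> A \<Longrightarrow> norm (w j) \<le> 1" and eq: "(\<Sum>j\<in>A. \<alpha> j *\<^sub>R w j) = 1"
    and j: "j \<in> A"
  shows "w j = 1"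
proof -
  obtain re :: "'k \<Rightarrow> real"
    where re: "linear re" "re 1 = 1" "\<And>c. re c \<le> norm c"
      and real: "\<And>c. norm c \<le> re c \<Longrightarrow> c = of_real (re c)"
    using real_or_complex_coordinates by metis
  have le1: "re (w i) \<le> 1" if "i \<in> A" for i
    using le[OF that] re(3)[of "w i"] by linarith
  have "(\<Sum>i\<in>A. \<alpha> i * re (w i)) = 1"
    using arg_cong[OF eq, of re] re(1,2) by (simp add: linear_sum linear_scale)
  then have "(\<Sum>i\<in>A. \<alpha> i * (1 - re (w i))) = 0"
    using A(3) by (simp add: algebra_simps sum_subtractf)
  moreover have "0 \<le> \<alpha> i * (1 - re (w i))" if "i \<in> A" for i
    using A(2)[OF that] le1[OF that] by simp
  ultimately have "\<alpha> j * (1 - re (w j)) = 0"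
    using A(1) j by (simp add: sum_nonneg_eq_0_iff)
  with A(2)[OF j] have one: "re (w j) = 1" by simp
  with le[OF j] have "w j = of_real (re (w j))" by (intro real) simp
  with one show ?thesis by simp
qed

section \<open>Norm-one functionals over the scalar field\<close>

lemma dual_sphere_norm_le:
  assumes "f \<in> dual_sphere smultY"
  shows "norm (f x) \<le> norm x"
  using onorm[of f x] assms by (simp add: dual_sphere_def bounded_operator_def)

text \<open>Multiplying \<open>x\<close> by a unimodular scalar \<open>d\<close> makes the value of
  \<open>f\<close> real and nonnegative without changing the norm of \<open>x\<close>, so the bound
  on real parts bounds the modulus.\<close>

lemma (in normed_space_over) norm_real_part_functional:
  fixes f :: "'v \<Rightarrow> 'k" and re :: "'k \<Rightarrow> real"
  assumes re: "\<And>r. re (of_real r) = r" and f: "\<And>c x. f (smult c x) = c * f x"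
    and le: "\<And>x. re (f x) \<le> norm x"
  shows "norm (f x) \<le> norm x"
proof (cases "f x = 0")
  case False
  define d where "d = of_real (norm (f x)) / f x"
  have "norm (f x) = re (f (smult d x))"
    using False by (simp add: f d_def re)
  also have "\<dots> \<le> norm (smult d x)" by (rule le)
  also have "\<dots> = norm x"
    using False by (simp add: norm_smult d_def norm_divide)
  finally show ?thesis .
qed simp

lemma (in normed_space_over) supporting_functional:
  assumes v: "v \<noteq> 0"
  obtains f where "f \<in> dual_sphere smult" "f v = of_real (norm v)"
proof -
  obtain u where u: "bounded_linear u" "u v = norm v" "\<And>x. u x \<le> norm x"
    using supporting_functional_real[of v] by blast
  obtain re im :: "'k \<Rightarrow> real" and iu
    where re: "linear re" "re 1 = 1" "re iu = 0"
      and real: "\<And>c. norm c \<le> re c \<Longrightarrow> c = of_real (re c)"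
      and dec: "\<And>c. c = of_real (re c) + of_real (im c) * iu"
      and iu: "iu = 0 \<or> iu * iu = -1"
    using real_or_complex_coordinates by metis
  interpret u: bounded_linear u by fact
  \<comment> \<open>The usual complexification of a real functional, whose real part is
    \<open>u\<close>; with \<open>iu = 0\<close> it reduces to \<open>u\<close> itself.\<close>
  define f where "f x = of_real (u x) - of_real (u (smult iu x)) * iu" for x
  have re_scale: "re (of_real a * c) = a * re c" for a c
    using linear_scale[OF re(1), of a c] by (simp add: scaleR_conv_of_real)
  have re_real: "re (of_real r) = r" for r
    using re_scale[of r 1] re(2) by simp
  have re_f: "re (f x) = u x" for x
    by (simp add: f_def linear_diff[OF re(1)] re_scale re_real re(3))
  have f_add: "f (x + y) = f x + f y" for x y
    by (simp add: f_def u.add scale_right_distrib algebra_simps)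
  have f_real: "f (r *\<^sub>R x) = of_real r * f x" for r x
  proof -
    have "smult iu (r *\<^sub>R x) = r *\<^sub>R smult iu x"
      unfolding smult_of_real[symmetric] by (simp add: mult.commute)
    then show ?thesis by (simp add: f_def u.scaleR algebra_simps)
  qed
  have f_iu: "f (smult iu x) = iu * f x" for x
  proof (cases "iu = 0")
    case True
    then show ?thesis by (simp add: f_def u.zero)
  next
    case False
    with iu have sq: "iu * iu = -1" by simp
    then have sq': "iu * (iu * c) = - c" for c by (simp flip: mult.assoc)
    have "smult iu (smult iu x) = - x" by (simp add: sq)
    then show ?thesis
      by (simp add: f_def u.neg algebra_simps sq')
  qed
  have f_smult: "f (smult c x) = c * f x" for c x
  proof -
    have "smult c x = re c *\<^sub>R x + im c *\<^sub>R smult iu x"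
      unfolding smult_of_real[symmetric] scale_scale scale_left_distrib[symmetric]
      using dec[of c] by simp
    then have "f (smult c x) = (of_real (re c) + of_real (im c) * iu) * f x"
      by (simp add: f_add f_real f_iu algebra_simps)
    with dec[of c] show ?thesis by simp
  qed
  have f_le: "norm (f x) \<le> norm x" for x
    using u(3) by (intro norm_real_part_functional[of re f] re_real f_smult) (simp add: re_f)
  have lin: "bounded_linear f"
    using f_add f_real f_le
    by (intro bounded_linear_intro[where K = 1]) (simp_all add: scaleR_conv_of_real)
  \<comment> \<open>The real part of \<open>f v\<close> already equals \<open>norm v\<close>, which
    bounds the modulus, so \<open>f v\<close> is real.\<close>
  have fv: "f v = of_real (norm v)"
    using real[of "f v"] f_le[of v] by (simp add: re_f u(2))
  have "onorm f \<le> 1" using f_le by (intro onorm_bound) simp_all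
  moreover have "norm v \<le> onorm f * norm v" using onorm[OF lin, of v] fv by simp
  then have "1 \<le> onorm f" using v by simp
  ultimately have "f \<in> dual_sphere smult"
    using lin f_smult by (simp add: dual_sphere_def bounded_operator_def)
  then show ?thesis using that fv by blast
qed

section \<open>Normalizing vectors whose convex combination is nearly extremal\<close>

text \<open>
  One \<open>\<eta>\<close> of the loss \<open>2 * \<eta>\<close> comes from the hypothesis, the other from the rescaling, which moves
  the convex combination by at most \<open>\<Sum>j\<in>A. \<alpha>\<^sub>j (1 - \<parallel>y\<^sub>j\<parallel>) < \<eta>\<close>.
\<close>

lemma convex_combinations_normalize:
  fixes y :: "'n \<Rightarrow> 'v::real_normed_vector"
  assumes A: "finite A" "\<And>j. j \<in> A \<Longrightarrow> \<alpha> j > 0" "(\<Sum>j\<in>A. \<alpha> j) = 1"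
    and y: "\<And>j. j \<in> A \<Longrightarrow> norm (y j) \<le> 1" and sum: "norm (\<Sum>j\<in>A. \<alpha> j *\<^sub>R y j) > 1 - \<eta>"
    and small: "\<And>j. j \<in> A \<Longrightarrow> \<eta> \<le> \<alpha> j * \<delta>" and "\<delta> \<le> 1"
  shows "\<And>j. j \<in> A \<Longrightarrow> norm (sgn (y j)) = 1"
    and "\<And>j. j \<in> A \<Longrightarrow> norm (sgn (y j) - y j) < \<delta>"
    and "norm (\<Sum>j\<in>A. \<alpha> j *\<^sub>R sgn (y j)) > 1 - 2 * \<eta>"
proof -
  have "norm (\<Sum>j\<in>A. \<alpha> j *\<^sub>R y j) \<le> (\<Sum>j\<in>A. \<alpha> j * norm (y j))"
    using A(2) by (intro sum_norm_le) (simp add: less_imp_le)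
  with sum have defect: "(\<Sum>j\<in>A. \<alpha> j * (1 - norm (y j))) < \<eta>"
    using A(3) by (simp add: right_diff_distrib sum_subtractf)
  \<comment> \<open>All terms of the defect sum are nonnegative, so each is below
    \<open>\<eta>\<close>; dividing by the weight explains the hypothesis
    \<open>\<eta> \<le> \<alpha> j * \<delta>\<close>.\<close>
  have gap: "1 - norm (y j) < \<delta>" if j: "j \<in> A" for j
  proof -
    have "\<alpha> j * (1 - norm (y j)) \<le> (\<Sum>j\<in>A. \<alpha> j * (1 - norm (y j)))"
      using A j y by (intro member_le_sum) (auto simp: less_imp_le)
    with defect small[OF j] have "\<alpha> j * (1 - norm (y j)) < \<alpha> j * \<delta>" by linarith
    with A(2)[OF j] show ?thesis by simp
  qed
  then have pos: "y j \<noteq> 0" if "j \<in> A" for j using \<open>\<delta> \<le> 1\<close> that by fastforce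
  then show "norm (sgn (y j)) = 1" if "j \<in> A" for j
    using that by (simp add: norm_sgn)
  \<comment> \<open>Normalization moves \<open>y j\<close> along its own ray, so the distance is
    exactly the missing length.\<close>
  have dist: "norm (sgn (y j) - y j) = 1 - norm (y j)" if j: "j \<in> A" for j
  proof -
    have "sgn (y j) - y j = (1 - norm (y j)) *\<^sub>R sgn (y j)"
      using pos[OF j] by (simp add: sgn_div_norm algebra_simps)
    then show ?thesis using pos[OF j] y[OF j] by (simp add: norm_sgn)
  qed
  then show "norm (sgn (y j) - y j) < \<delta>" if "j \<in> A" for j using gap that by simp
  have "norm (\<Sum>j\<in>A. \<alpha> j *\<^sub>R (sgn (y j) - y j)) \<le> (\<Sum>j\<in>A. \<alpha> j * (1 - norm (y j)))"
    using A(2) dist by (intro sum_norm_le) (simp add: less_imp_le)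
  moreover have "(\<Sum>j\<in>A. \<alpha> j *\<^sub>R y j) =
      (\<Sum>j\<in>A. \<alpha> j *\<^sub>R sgn (y j)) - (\<Sum>j\<in>A. \<alpha> j *\<^sub>R (sgn (y j) - y j))"
    by (simp add: scaleR_diff_right sum_subtractf)
  then have "norm (\<Sum>j\<in>A. \<alpha> j *\<^sub>R y j) \<le>
      norm (\<Sum>j\<in>A. \<alpha> j *\<^sub>R sgn (y j)) + norm (\<Sum>j\<in>A. \<alpha> j *\<^sub>R (sgn (y j) - y j))"
    by (simp only: norm_triangle_ineq4)
  ultimately show "norm (\<Sum>j\<in>A. \<alpha> j *\<^sub>R sgn (y j)) > 1 - 2 * \<eta>"
    using sum defect by linarith
qed

section \<open>Operators on \<open>\<ell>\<^sub>1\<^sup>N\<close>\<close>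

definition l1_unit :: "'n \<Rightarrow> ('k::real_or_complex, 'n::finite) l1"
  where "l1_unit j = l1_of (\<lambda>i. if i = j then 1 else 0)"

definition l1_operator ::
  "('k::real_or_complex \<Rightarrow> 'y \<Rightarrow> 'y) \<Rightarrow> ('n \<Rightarrow> 'y) \<Rightarrow> ('k, 'n::finite) l1 \<Rightarrow> 'y::real_normed_vector"
  where "l1_operator smultY y x = (\<Sum>j\<in>UNIV. smultY (coord x j) (y j))"

lemma norm_l1_unit [simp]: "norm (l1_unit j) = 1"
  by (simp add: norm_l1_def l1_unit_def if_distrib[of norm] cong: if_cong)

lemma coord_sum: "coord (\<Sum>i\<in>I. g i) j = (\<Sum>i\<in>I. coord (g i) j)"
  by (induction I rule: infinite_finite_induct) (simp_all add: zero_l1_def plus_l1_def)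

lemma l1_expansion: "x = (\<Sum>j\<in>UNIV. l1_smult (coord x j) (l1_unit j))"
  by (simp add: l1_eq_iff coord_sum l1_smult_def l1_unit_def if_distrib[of "(*) _"] cong: if_cong)

lemma bounded_operator_norm_unit_le:
  assumes "bounded_operator smultX smultY T"
  shows "norm (T (l1_unit j)) \<le> onorm T"
  using onorm[of T "l1_unit j"] assms by (simp add: bounded_operator_def)

context normed_space_over
begin

lemma l1_operator_unit [simp]: "l1_operator smult y (l1_unit j) = y j"
  by (simp add: l1_operator_def l1_unit_def if_distrib[of "\<lambda>c. smult c _"] if_distribR cong: if_cong)

lemma bounded_operator_eq_l1_operator:
  assumes "bounded_operator l1_smult smult T"
  shows "T = l1_operator smult (\<lambda>j. T (l1_unit j))"
proof
  fix x
  have lin: "linear T" using assms by (simp add: bounded_operator_def bounded_linear.linear)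
  show "T x = l1_operator smult (\<lambda>j. T (l1_unit j)) x"
    using assms by (subst l1_expansion) (simp add: linear_sum[OF lin] l1_operator_def bounded_operator_def)
qed

lemma norm_l1_operator_le:
  assumes "\<And>j. norm (y j) \<le> B"
  shows "norm (l1_operator smult y x) \<le> B * norm x"
proof -
  have "norm (l1_operator smult y x) \<le> (\<Sum>j\<in>UNIV. norm (coord x j) * B)"
    unfolding l1_operator_def using assms
    by (intro sum_norm_le) (simp add: norm_smult mult_left_mono)
  then show ?thesis by (simp add: norm_l1_def sum_distrib_left mult.commute)
qed

lemma bounded_operator_l1_operator: "bounded_operator l1_smult smult (l1_operator smult y)"
proof -
  \<comment> \<open>With finitely many coordinates, this crude bound makes every family
    \<open>y\<close> define a bounded operator.\<close>
  have "norm (y j) \<le> (\<Sum>j\<in>UNIV. norm (y j))" for j by (intro member_le_sum) auto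
  from norm_l1_operator_le[OF this] have "bounded_linear (l1_operator smult y)"
    by (intro bounded_linear_intro[where K = "\<Sum>j\<in>UNIV. norm (y j)"])
      (simp_all add: mult.commute[of "norm _"], simp_all add: l1_operator_def plus_l1_def scaleR_l1_def
        scale_left_distrib sum.distrib scale_sum_right scaleR_conv_of_real[where 'a = 'k]
        flip: smult_of_real)
  then show ?thesis
    by (simp add: bounded_operator_def l1_operator_def l1_smult_def scale_sum_right)
qed

lemma onorm_l1_operator_le:
  assumes "\<And>j. norm (y j) \<le> B"
  shows "onorm (l1_operator smult y) \<le> B"
proof (rule onorm_bound)
  show "0 \<le> B" using assms norm_ge_zero order_trans by blast
qed (rule norm_l1_operator_le[OF assms])

lemma l1_operator_diff:
  "l1_operator smult y x - l1_operator smult z x = l1_operator smult (\<lambda>j. y j - z j) x"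
  by (simp add: l1_operator_def sum_subtractf scale_right_diff_distrib)

section \<open>The two implications\<close>

lemma property_Lpp_l1_imp_convex_combinations:
  fixes A :: "'n::finite set"
  assumes L: "property_Lpp (l1_smult :: 'k \<Rightarrow> ('k, 'n) l1 \<Rightarrow> ('k, 'n) l1) smult"
    and \<epsilon>: "\<epsilon> > 0" and A: "A \<noteq> {}" "\<And>j. j \<in> A \<Longrightarrow> \<alpha> j > 0" "(\<Sum>j\<in>A. \<alpha> j) = 1"
  shows "\<exists>\<eta>>0. \<forall>y. (\<forall>j\<in>A. norm (y j) = 1) \<and> norm (\<Sum>j\<in>A. \<alpha> j *\<^sub>R y j) > 1 - \<eta> \<longrightarrow>
    (\<exists>f\<in>dual_sphere smult. \<exists>z. \<forall>j\<in>A. norm (z j) = 1 \<and> f (z j) = 1 \<and> norm (z j - y j) < \<epsilon>)"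
proof -
  define x :: "('k, 'n) l1" where "x = l1_of (\<lambda>j. if j \<in> A then of_real (\<alpha> j) else 0)"
  have "norm x = (\<Sum>j\<in>UNIV. if j \<in> A then \<alpha> j else 0)"
    unfolding norm_l1_def x_def using A(2) by (intro sum.cong) (auto simp: less_imp_le)
  then have x: "x \<in> sphere 0 1" using A(3) by (simp add: sum.If_cases)
  have op_x: "l1_operator smult y x = (\<Sum>j\<in>A. \<alpha> j *\<^sub>R y j)" for y
  proof -
    have "l1_operator smult y x = (\<Sum>j\<in>UNIV. if j \<in> A then \<alpha> j *\<^sub>R y j else 0)"
      unfolding l1_operator_def x_def by (intro sum.cong) (auto simp: smult_of_real)
    then show ?thesis by (simp add: sum.If_cases)
  qed
  obtain \<eta> where "\<eta> > 0" and \<eta>: "\<And>T. bounded_operator (l1_smult :: 'k \<Rightarrow> ('k, 'n) l1 \<Rightarrow> _) smult T \<Longrightarrow>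
      onorm T = 1 \<Longrightarrow> norm (T x) > 1 - \<eta> \<Longrightarrow>
      \<exists>S. bounded_operator l1_smult smult S \<and> onorm S = 1 \<and> norm (S x) = 1 \<and>
        onorm (\<lambda>u. S u - T u) < \<epsilon>"
    using L[unfolded property_Lpp_def, rule_format, OF \<epsilon> x] by blast
  have "\<exists>f\<in>dual_sphere smult. \<exists>z. \<forall>j\<in>A. norm (z j) = 1 \<and> f (z j) = 1 \<and> norm (z j - y j) < \<epsilon>"
    if y: "\<And>j. j \<in> A \<Longrightarrow> norm (y j) = 1" and sum: "norm (\<Sum>j\<in>A. \<alpha> j *\<^sub>R y j) > 1 - \<eta>" for y
  proof -
    \<comment> \<open>Nothing is known about \<open>y\<close> outside \<open>A\<close>. Setting it
      to zero there keeps the operator norm at most one and does not affect the value at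
      \<open>x\<close>.\<close>
    define y' where "y' j = (if j \<in> A then y j else 0)" for j
    define T :: "('k, 'n) l1 \<Rightarrow> 'v" where "T = l1_operator smult y'"
    have T: "bounded_operator l1_smult smult T"
      unfolding T_def by (rule bounded_operator_l1_operator)
    obtain i where "i \<in> A" using A(1) by blast
    then have "1 \<le> onorm T"
      using bounded_operator_norm_unit_le[OF T, of i] by (simp add: T_def y'_def y)
    moreover have "onorm T \<le> 1"
      unfolding T_def by (rule onorm_l1_operator_le) (simp add: y'_def y)
    moreover have "norm (T x) > 1 - \<eta>"
      using sum by (simp add: T_def op_x y'_def)
    ultimately obtain S where S: "bounded_operator l1_smult smult S" "onorm S = 1"
      "norm (S x) = 1" "onorm (\<lambda>u. S u - T u) < \<epsilon>"
      using \<eta>[OF T] by force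
    define z where "z j = S (l1_unit j)" for j
    have S_eq: "S = l1_operator smult z"
      unfolding z_def by (rule bounded_operator_eq_l1_operator[OF S(1)])
    have z_le: "norm (z j) \<le> 1" for j
      using bounded_operator_norm_unit_le[OF S(1), of j] S(2) by (simp add: z_def)
    obtain f where f: "f \<in> dual_sphere smult" "f (S x) = 1"
      using supporting_functional[of "S x"] S(3) by (metis norm_zero of_real_1 zero_neq_one)
    then have "linear f"
      by (simp add: dual_sphere_def bounded_operator_def bounded_linear.linear)
    then have fsum: "(\<Sum>j\<in>A. \<alpha> j *\<^sub>R f (z j)) = 1"
      using f(2) by (simp add: S_eq op_x linear_sum linear_scale)
    have fz_le: "norm (f (z j)) \<le> norm (z j)" for j
      by (rule dual_sphere_norm_le[OF f(1)])
    have fz: "f (z j) = 1" if "j \<in> A" for j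
      using A(2,3) fsum that order_trans[OF fz_le z_le]
      by (intro convex_combination_eq_one[of A \<alpha> "\<lambda>j. f (z j)"]) auto
    \<comment> \<open>Evaluate the difference of the operators at a unit vector.\<close>
    have "norm (z j - y j) < \<epsilon>" if "j \<in> A" for j
    proof -
      have "bounded_linear (\<lambda>u. S u - T u)"
        using S(1) T by (intro bounded_linear_sub) (simp_all add: bounded_operator_def)
      from onorm[OF this, of "l1_unit j"] have "norm (z j - y j) \<le> onorm (\<lambda>u. S u - T u)"
        using that by (simp add: z_def T_def y'_def)
      with S(4) show ?thesis by simp
    qed
    \<comment> \<open>Here \<open>1 = norm (f (z j)) \<le> norm (z j) \<le> 1\<close>.\<close>
    moreover have "norm (z j) = 1" if "j \<in> A" for j
      using fz_le[of j] fz[OF that] z_le[of j] by simp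
    ultimately show ?thesis using f(1) fz by blast
  qed
  with \<open>\<eta> > 0\<close> show ?thesis by blast
qed

lemma convex_combinations_imp_norm_attaining:
  fixes x :: "('k, 'n::finite) l1"
  assumes x: "norm x = 1" and "\<epsilon> > 0"
    and convex: "\<And>\<delta> A \<alpha>. \<delta> > 0 \<Longrightarrow> A \<noteq> {} \<Longrightarrow> (\<And>j. j \<in> A \<Longrightarrow> \<alpha> j > 0) \<Longrightarrow> (\<Sum>j\<in>A. \<alpha> j) = 1 \<Longrightarrow>
      \<exists>\<eta>>0. \<forall>y :: 'n \<Rightarrow> 'v. (\<forall>j\<in>A. norm (y j) = 1) \<and> norm (\<Sum>j\<in>A. \<alpha> j *\<^sub>R y j) > 1 - \<eta> \<longrightarrow>
        (\<exists>f\<in>dual_sphere smult. \<exists>z. \<forall>j\<in>A. norm (z j) = 1 \<and> f (z j) = 1 \<and> norm (z j - y j) < \<delta>)"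
  shows "\<exists>\<eta>>0. \<forall>T. bounded_operator l1_smult smult T \<and> onorm T = 1 \<and> norm (T x) > 1 - \<eta> \<longrightarrow>
    (\<exists>S. bounded_operator l1_smult smult S \<and> onorm S = 1 \<and> norm (S x) = 1 \<and>
      onorm (\<lambda>u. S u - T u) < \<epsilon>)"
proof -
  define A where "A = {j. coord x j \<noteq> 0}"
  define \<alpha> where "\<alpha> j = norm (coord x j)" for j
  \<comment> \<open>Normalizing and replacing by \<open>z j\<close> cost less than
    \<open>\<delta>\<close> each, and a third of \<open>\<epsilon>\<close> leaves room for strict
    inequality of the operator norm. The cap at one is required by
    \<open>convex_combinations_normalize\<close>.\<close>
  define \<delta> where "\<delta> = min 1 (\<epsilon> / 3)"
  have \<delta>: "\<delta> > 0" "\<delta> \<le> 1" "2 * \<delta> < \<epsilon>" using \<open>\<epsilon> > 0\<close> by (auto simp: \<delta>_def)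
  have \<alpha>: "\<alpha> j > 0" if "j \<in> A" for j using that by (simp add: A_def \<alpha>_def)
  have sum\<alpha>: "(\<Sum>j\<in>A. \<alpha> j) = 1"
    using x unfolding norm_l1_def \<alpha>_def A_def by (subst sum.mono_neutral_left[of UNIV]) auto
  then have "A \<noteq> {}" by auto
  have "\<exists>\<eta>>0. \<forall>y :: 'n \<Rightarrow> 'v. (\<forall>j\<in>A. norm (y j) = 1) \<and> norm (\<Sum>j\<in>A. \<alpha> j *\<^sub>R y j) > 1 - \<eta> \<longrightarrow>
      (\<exists>f\<in>dual_sphere smult. \<exists>z. \<forall>j\<in>A. norm (z j) = 1 \<and> f (z j) = 1 \<and> norm (z j - y j) < \<delta>)"
    by (rule convex) (use \<delta>(1) \<open>A \<noteq> {}\<close> \<alpha> sum\<alpha> in simp_all)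
  then obtain \<eta>0 where "\<eta>0 > 0" and \<eta>0: "\<forall>y :: 'n \<Rightarrow> 'v.
      (\<forall>j\<in>A. norm (y j) = 1) \<and> norm (\<Sum>j\<in>A. \<alpha> j *\<^sub>R y j) > 1 - \<eta>0 \<longrightarrow>
      (\<exists>f\<in>dual_sphere smult. \<exists>z. \<forall>j\<in>A. norm (z j) = 1 \<and> f (z j) = 1 \<and> norm (z j - y j) < \<delta>)"
    by (elim exE conjE)
  \<comment> \<open>Halving \<open>\<eta>0\<close> absorbs the loss \<open>2 * \<eta>\<close> of the
    normalization; the second term makes \<open>\<eta> \<le> \<alpha> j * \<delta>\<close> for every
    \<open>j\<close> in \<open>A\<close>.\<close>
  define \<eta> where "\<eta> = min (\<eta>0 / 2) (Min (\<alpha> ` A) * \<delta>)"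
  have "Min (\<alpha> ` A) > 0"
    using \<alpha> \<open>A \<noteq> {}\<close> by (subst Min_gr_iff) auto
  then have "\<eta> > 0"
    unfolding \<eta>_def using \<open>\<eta>0 > 0\<close> \<delta>(1) by (simp only: min_less_iff_conj mult_pos_pos half_gt_zero)
  have small: "\<eta> \<le> \<alpha> j * \<delta>" if "j \<in> A" for j
  proof -
    have "Min (\<alpha> ` A) \<le> \<alpha> j" using that by simp
    with \<delta>(1) have "Min (\<alpha> ` A) * \<delta> \<le> \<alpha> j * \<delta>" by (intro mult_right_mono) auto
    then show ?thesis unfolding \<eta>_def by (rule min.coboundedI2)
  qed
  \<comment> \<open>The sign of the coordinate: the rotation that turns \<open>T x\<close> into a
    combination with the positive weights \<open>\<alpha> j\<close>.\<close>
  define s where "s j = coord x j / of_real (\<alpha> j)" for j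
  have s: "norm (s j) = 1" if "j \<in> A" for j
    using \<alpha>[OF that] by (simp add: s_def norm_divide \<alpha>_def)
  have s_inv: "s j * inverse (s j) = 1" if "j \<in> A" for j
    using s[OF that] by (metis norm_zero right_inverse zero_neq_one)
  have op_x: "l1_operator smult w x = (\<Sum>j\<in>A. \<alpha> j *\<^sub>R smult (s j) (w j))" for w
  proof -
    have "l1_operator smult w x = (\<Sum>j\<in>A. smult (coord x j) (w j))"
      unfolding l1_operator_def A_def by (rule sum.mono_neutral_right) auto
    also have "\<dots> = (\<Sum>j\<in>A. \<alpha> j *\<^sub>R smult (s j) (w j))"
    proof (rule sum.cong)
      fix j assume "j \<in> A"
      then have "of_real (\<alpha> j) * s j = coord x j" using \<alpha>[of j] by (simp add: s_def)
      then show "smult (coord x j) (w j) = \<alpha> j *\<^sub>R smult (s j) (w j)"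
        by (simp flip: smult_of_real)
    qed simp
    finally show ?thesis .
  qed
  have "\<exists>S. bounded_operator l1_smult smult S \<and> onorm S = 1 \<and> norm (S x) = 1 \<and>
      onorm (\<lambda>u. S u - T u) < \<epsilon>"
    if T: "bounded_operator (l1_smult :: 'k \<Rightarrow> ('k, 'n) l1 \<Rightarrow> _) smult T" "onorm T = 1"
      and Tx: "norm (T x) > 1 - \<eta>" for T
  proof -
    define t where "t j = T (l1_unit j)" for j
    have t_le: "norm (t j) \<le> 1" for j
      using bounded_operator_norm_unit_le[OF T(1), of j] T(2) by (simp add: t_def)
    have T_eq: "T = l1_operator smult t"
      unfolding t_def by (rule bounded_operator_eq_l1_operator[OF T(1)])
    define y where "y j = smult (s j) (t j)" for j
    have y_le: "norm (y j) \<le> 1" if "j \<in> A" for j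
      using t_le s[OF that] by (simp add: y_def norm_smult)
    have y_sum: "norm (\<Sum>j\<in>A. \<alpha> j *\<^sub>R y j) > 1 - \<eta>"
      using Tx by (simp add: T_eq op_x y_def)
    have normalize: "\<And>j. j \<in> A \<Longrightarrow> norm (sgn (y j)) = 1"
      "\<And>j. j \<in> A \<Longrightarrow> norm (sgn (y j) - y j) < \<delta>"
      "norm (\<Sum>j\<in>A. \<alpha> j *\<^sub>R sgn (y j)) > 1 - 2 * \<eta>"
      by (rule convex_combinations_normalize[of A \<alpha> y \<eta> \<delta>];
          use \<alpha> sum\<alpha> y_le y_sum small \<delta>(2) in simp)+
    have "norm (\<Sum>j\<in>A. \<alpha> j *\<^sub>R sgn (y j)) > 1 - \<eta>0"
      using normalize(3) by (simp add: \<eta>_def)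
    then obtain f z where f: "f \<in> dual_sphere smult"
      and z: "\<And>j. j \<in> A \<Longrightarrow> norm (z j) = 1 \<and> f (z j) = 1 \<and> norm (z j - sgn (y j)) < \<delta>"
      using \<eta>0[rule_format, of "\<lambda>j. sgn (y j)"] normalize(1) by blast
    \<comment> \<open>On \<open>A\<close> the rotation is undone. Off \<open>A\<close> the images
      under \<open>T\<close> are kept: they do not enter \<open>S x\<close>, and the difference to
      \<open>T\<close> vanishes there.\<close>
    define w where "w j = (if j \<in> A then smult (inverse (s j)) (z j) else t j)" for j
    define S :: "('k, 'n) l1 \<Rightarrow> 'v" where "S = l1_operator smult w"
    have S: "bounded_operator l1_smult smult S"
      unfolding S_def by (rule bounded_operator_l1_operator)
    have "norm (w j) \<le> 1" for j
      using z s t_le by (simp add: w_def norm_smult norm_inverse)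
    then have S_le: "onorm S \<le> 1"
      unfolding S_def by (rule onorm_l1_operator_le)
    have Sx: "S x = (\<Sum>j\<in>A. \<alpha> j *\<^sub>R z j)"
      unfolding S_def op_x by (intro sum.cong) (simp_all add: w_def s_inv)
    have "linear f"
      using f by (simp add: dual_sphere_def bounded_operator_def bounded_linear.linear)
    \<comment> \<open>The common functional \<open>f\<close> equals one at every \<open>z j\<close>,
      hence at their convex combination \<open>S x\<close>, which forces the norm to be attained
      there.\<close>
    then have "f (S x) = (\<Sum>j\<in>A. of_real (\<alpha> j))"
      using z by (simp add: Sx linear_sum linear_scale scaleR_conv_of_real)
    also have "\<dots> = 1" using sum\<alpha> by (metis of_real_1 of_real_sum)
    finally have "1 \<le> norm (S x)"
      using dual_sphere_norm_le[OF f, of "S x"] by simp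
    moreover have "norm (S x) \<le> onorm S"
      using onorm[of S x] S x by (simp add: bounded_operator_def)
    ultimately have "onorm S = 1" "norm (S x) = 1" using S_le by auto
    moreover have "norm (w j - t j) \<le> 2 * \<delta>" for j
    proof (cases "j \<in> A")
      case True
      \<comment> \<open>Multiplication by the unimodular \<open>s j\<close> is isometric, so the
        distance may be measured after the rotation.\<close>
      have "smult (s j) (w j - t j) = z j - y j"
        using True s_inv[OF True] by (simp add: w_def y_def scale_right_diff_distrib)
      then have "norm (w j - t j) = norm (z j - y j)"
        using s[OF True] by (metis mult_1 norm_smult)
      also have "\<dots> \<le> norm (z j - sgn (y j)) + norm (sgn (y j) - y j)"
        using norm_triangle_ineq[of "z j - sgn (y j)" "sgn (y j) - y j"] by simp
      also have "\<dots> \<le> 2 * \<delta>"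
        using z[OF True] normalize(2)[OF True] by linarith
      finally show ?thesis .
    qed (use \<delta>(1) in \<open>simp add: w_def\<close>)
    then have "onorm (\<lambda>u. S u - T u) \<le> 2 * \<delta>"
      unfolding S_def T_eq l1_operator_diff by (rule onorm_l1_operator_le)
    then have "onorm (\<lambda>u. S u - T u) < \<epsilon>" using \<delta>(3) by linarith
    ultimately show ?thesis using S by blast
  qed
  with \<open>\<eta> > 0\<close> show ?thesis by blast
qed

end

theorem proposition3p5:
  fixes smultY :: "'k::real_or_complex \<Rightarrow> 'y::banach \<Rightarrow> 'y"
  assumes "normed_space_over smultY"
  shows "property_Lpp (l1_smult :: 'k \<Rightarrow> ('k, 'n::finite) l1 \<Rightarrow> ('k, 'n) l1) smultY \<longleftrightarrow>
    (\<forall>\<epsilon>>0. \<forall>(A :: 'n set) (\<alpha> :: 'n \<Rightarrow> real).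
       A \<noteq> {} \<and> (\<forall>j\<in>A. \<alpha> j > 0) \<and> (\<Sum>j\<in>A. \<alpha> j) = 1 \<longrightarrow>
       (\<exists>\<eta>>0. \<forall>y :: 'n \<Rightarrow> 'y.
          (\<forall>j\<in>A. y j \<in> sphere 0 1) \<and> norm (\<Sum>j\<in>A. \<alpha> j *\<^sub>R y j) > 1 - \<eta> \<longrightarrow>
          (\<exists>zstar \<in> dual_sphere smultY. \<exists>z :: 'n \<Rightarrow> 'y.
             \<forall>j\<in>A. z j \<in> sphere 0 1 \<and> zstar (z j) = 1 \<and> norm (z j - y j) < \<epsilon>)))"
proof -
  interpret normed_space_over smultY by fact
  have sphere: "v \<in> sphere 0 1 \<longleftrightarrow> norm v = 1" for v :: "'a::real_normed_vector"
    by simp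
  show ?thesis (is "?L \<longleftrightarrow> ?R")
  proof
    assume ?L
    then show ?R
      unfolding sphere by (blast intro: property_Lpp_l1_imp_convex_combinations)
  next
    assume ?R
    then show ?L
      unfolding property_Lpp_def sphere
      by (intro allI impI ballI convex_combinations_imp_norm_attaining) auto
  qed
qed

end
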